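(* Let $\gamma\ge 0$ and let $\mathcal M=(f,\mathbf p)$ be an auction that is truthful for simple value maximizers, individually rational for simple value maximizers, and has no positive transfers. Suppose every bidder $i$ has super-quasilinear preferences $\preceq_i$ together with an ROI constraint $\gamma$, and suppose that $$v_i\,x_i(o)\,\frac{\gamma}{\gamma+1}\;\ge\; v_i\,x_i(o')\qquad\text{for all } i,\ v_i,\ o,o'\in\mathcal O \text{ with } x_i(o)>x_i(o').$$ Then no bidder wishes to lie: for every bidder $i$ and all bids $b_{-i}$ of the others, writing $w_i=\frac{v_i}{1+\gamma}$ for the maximum price per click that bidder $i$ is willing to pay, for every alternative bid $b_i$, $$\big(f(b_{-i},w_i),\,p_i(b_{-i},w_i)\big)\;\succeq_i\;\big(f(b_{-i},b_i),\,p_i(b_{-i},b_i)\big).$$ This holds for all $v_i$ if "truthful" is taken to mean DSIC, and for all $v_i$ outside a set of measure zero (depending on $i$ and $b_{-i}$) if "truthful" is taken to mean DSIC-AE.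
   Context: Setting. There are $n$ bidders (advertisers) and a set $\mathcal O$ of outcomes. In outcome $o$, bidder $i$'s ad is clicked with probability $x_i(o)\ge 0$ (its allocation). Bidder $i$ pays a price $p_i$ per click. Bidder $i$ has a private value per click $v_i\in(0,\infty)$ and a complete transitive preference $\preceq_i$ over pairs $(o,p_i)$, depending on $(o,p_i)$ only through $(x_i(o),p_i)$ (and on $v_i$). Auction. A (deterministic) auction $\mathcal M=(f,\mathbf p)$ maps a bid profile $\mathbf b\in(0,\infty)^n$ to an outcome $f(\mathbf b)\in\mathcal O$ and prices per click $p_i(\mathbf b)\in\mathbb R$. Simple value maximizer with value $v_i$: a pair $(o,p_i)$ is feasible if $p_i\le v_i$. If $(o,p_i)$ is feasible and $v_ix_i(o)>v_ix_i(o')$, then $(o,p_i)\succ_i(o',p_i')$. If $(o,p_i)$ is feasible, $x_i(o)=x_i(o')$ and $p_i<p_i'$, then $(o,p_i)\succ_i(o',p_i')$. If $(o',p_i')$ is infeasible, then $(o,p_i)\succeq_i(o',p_i')$ for every $(o,p_i)$. Truthful for simple value maximizers. DSIC: for all $i$, $v_i$, $b_{-i}$, $b_i$, a simple value maximizer with value $v_i$ satisfies $(f(b_{-i},v_i),p_i(b_{-i},v_i))\succeq_i(f(b_{-i},b_i),p_i(b_{-i},b_i))$. DSIC-AE: for each $i$ and $b_{-i}$ this holds for all $b_i$ and all $v_i$ except a set of $v_i$ of measure zero. Individually rational for simple value maximizers: a bidder reporting truthfully is at least as happy as if she had not participated (not participating means allocation 0 and payment 0); for simple value maximizers this means $p_i(b_{-i},v_i)\le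 v_i$. No positive transfers: $p_i(\mathbf b)\ge 0$ always. ROI constraint $\gamma$: a pair $(o,p_i)$ satisfies the constraint if $\frac{v_i-p_i}{p_i}\ge\gamma$, read as $p_i\le \frac{v_i}{1+\gamma}$ (so price $0$ is allowed). Super-quasilinear preferences with ROI constraint $\gamma$: whenever $(o,p_i)$ satisfies the ROI constraint, $v_ix_i(o)\ge v_ix_i(o')$ and $(v_i-p_i)x_i(o)\ge(v_i-p_i')x_i(o')$, one has $(o,p_i)\succeq_i(o',p_i')$; and any pair is weakly preferred to a pair violating the ROI constraint. *)

theory Defs
  imports "HOL-Analysis.Analysis"
begin

text \<open>
  Bidders are the elements of a finite type \<open>'n\<close>, outcomes the elements of a type \<open>'o\<close>.
  A bid profile is a function \<open>b :: 'n \<Rightarrow> real\<close> with positive values, and \<open>b(i := v)\<close> stands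
  for \<open>(b\<^sub>-\<^sub>i, v)\<close>. A preference is given by its weak part: \<open>R A B\<close> means that \<open>A\<close> is weakly
  preferred to \<open>B\<close>.
\<close>

type_synonym 'n bids = "'n \<Rightarrow> real"

type_synonym 'o pref = "'o \<times> real \<Rightarrow> 'o \<times> real \<Rightarrow> bool"

type_synonym ('n, 'o) auction = "('n bids \<Rightarrow> 'o) \<times> ('n \<Rightarrow> 'n bids \<Rightarrow> real)"

definition bid_profile :: "'n bids \<Rightarrow> bool" where
  "bid_profile b \<longleftrightarrow> (\<forall>i. 0 < b i)"

definition result :: "('n, 'o) auction \<Rightarrow> 'n \<Rightarrow> 'n bids \<Rightarrow> 'o \<times> real" where
  "result M i b = (fst M b, snd M i b)"

definition strictly :: "'o pref \<Rightarrow> 'o pref" where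
  "strictly R A B \<longleftrightarrow> R A B \<and> \<not> R B A"

definition preference :: "('o \<Rightarrow> real) \<Rightarrow> 'o pref \<Rightarrow> bool" where
  "preference xi R \<longleftrightarrow>
     (\<forall>A B. R A B \<or> R B A) \<and> transp R \<and>
     (\<forall>o1 o1' o2 o2' p1 p2. xi o1 = xi o1' \<longrightarrow> xi o2 = xi o2' \<longrightarrow>
        R (o1, p1) (o2, p2) = R (o1', p1) (o2', p2))"

definition simple_value_maximizer :: "real \<Rightarrow> ('o \<Rightarrow> real) \<Rightarrow> 'o pref \<Rightarrow> bool" where
  "simple_value_maximizer v xi R \<longleftrightarrow>
     preference xi R \<and>
     (\<forall>o1 p1 o2 p2. p1 \<le> v \<longrightarrow> v * xi o1 > v * xi o2 \<longrightarrow> strictly R (o1, p1) (o2, p2)) \<and>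
     (\<forall>o1 p1 o2 p2. p1 \<le> v \<longrightarrow> xi o1 = xi o2 \<longrightarrow> p1 < p2 \<longrightarrow> strictly R (o1, p1) (o2, p2)) \<and>
     (\<forall>o1 p1 o2 p2. \<not> p2 \<le> v \<longrightarrow> R (o1, p1) (o2, p2))"

definition no_gain_SVM ::
    "('n \<Rightarrow> 'o \<Rightarrow> real) \<Rightarrow> ('n, 'o) auction \<Rightarrow> 'n \<Rightarrow> 'n bids \<Rightarrow> real \<Rightarrow> bool" where
  "no_gain_SVM x M i b v \<longleftrightarrow>
     (\<forall>R bi. simple_value_maximizer v (x i) R \<longrightarrow> 0 < bi \<longrightarrow>
        R (result M i (b(i := v))) (result M i (b(i := bi))))"

definition DSIC_SVM :: "('n \<Rightarrow> 'o \<Rightarrow> real) \<Rightarrow> ('n, 'o) auction \<Rightarrow> bool" where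
  "DSIC_SVM x M \<longleftrightarrow>
     (\<forall>i b v. bid_profile b \<longrightarrow> 0 < v \<longrightarrow> no_gain_SVM x M i b v)"

definition DSIC_AE_SVM :: "('n \<Rightarrow> 'o \<Rightarrow> real) \<Rightarrow> ('n, 'o) auction \<Rightarrow> bool" where
  "DSIC_AE_SVM x M \<longleftrightarrow>
     (\<forall>i b. bid_profile b \<longrightarrow> (AE v in lborel. 0 < v \<longrightarrow> no_gain_SVM x M i b v))"

definition individually_rational_SVM :: "('n, 'o) auction \<Rightarrow> bool" where
  "individually_rational_SVM M \<longleftrightarrow>
     (\<forall>i b v. bid_profile b \<longrightarrow> 0 < v \<longrightarrow> snd M i (b(i := v)) \<le> v)"

definition no_positive_transfers :: "('n, 'o) auction \<Rightarrow> bool" where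
  "no_positive_transfers M \<longleftrightarrow> (\<forall>i b. bid_profile b \<longrightarrow> 0 \<le> snd M i b)"

text \<open>For \<open>p > 0\<close> this is \<open>(v - p) / p \<ge> \<gamma>\<close>; this form also allows the price \<open>0\<close>.\<close>

definition satisfies_ROI :: "real \<Rightarrow> real \<Rightarrow> real \<Rightarrow> bool" where
  "satisfies_ROI \<gamma> v p \<longleftrightarrow> p \<le> v / (1 + \<gamma>)"

definition super_quasilinear_ROI :: "real \<Rightarrow> real \<Rightarrow> ('o \<Rightarrow> real) \<Rightarrow> 'o pref \<Rightarrow> bool" where
  "super_quasilinear_ROI \<gamma> v xi R \<longleftrightarrow>
     preference xi R \<and>
     (\<forall>o1 p1 o2 p2. satisfies_ROI \<gamma> v p1 \<longrightarrow> v * xi o1 \<ge> v * xi o2 \<longrightarrow>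
        (v - p1) * xi o1 \<ge> (v - p2) * xi o2 \<longrightarrow> R (o1, p1) (o2, p2)) \<and>
     (\<forall>o1 p1 o2 p2. \<not> satisfies_ROI \<gamma> v p2 \<longrightarrow> R (o1, p1) (o2, p2))"

text \<open>
  Both classes of preferences are inhabited, so quantifying over their members is not vacuous.
  The simple value maximizer preference is moreover unique: all infeasible pairs are equivalent,
  and \<open>(o, p)\<close> with \<open>p \<le> v\<close> is strictly preferred to the infeasible \<open>(o, v + 1)\<close>.
\<close>

lemma simple_value_maximizer_iff:
  assumes "0 < v"
  shows "simple_value_maximizer v xi R \<longleftrightarrow>
    R = (\<lambda>(o1, p1) (o2, p2). v < p2 \<or> p1 \<le> v \<and> (xi o2 < xi o1 \<or> xi o1 = xi o2 \<and> p1 \<le> p2))"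
    (is "_ \<longleftrightarrow> R = ?S")
proof
  show "simple_value_maximizer v xi R" if "R = ?S"
    using assms unfolding that
    by (fastforce simp: simple_value_maximizer_def preference_def strictly_def transp_def)
next
  assume svm: "simple_value_maximizer v xi R"
  have tot: "R A B \<or> R B A" for A B
    using svm unfolding simple_value_maximizer_def preference_def by blast
  have tr: "R A C" if "R A B" "R B C" for A B C
    using svm that unfolding simple_value_maximizer_def preference_def transp_def by blast
  have dep: "R (o1, p) (o2, q) = R (o2, p) (o2, q)" if "xi o1 = xi o2" for o1 o2 p q
    using svm that unfolding simple_value_maximizer_def preference_def by blast
  have gt: "R (o1, p1) (o2, p2) \<and> \<not> R (o2, p2) (o1, p1)"
    if "p1 \<le> v" "xi o2 < xi o1" for o1 o2 p1 p2
    using svm that assms unfolding simple_value_maximizer_def strictly_def by simp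
  have eq: "R (o1, p1) (o2, p2) \<and> \<not> R (o2, p2) (o1, p1)"
    if "p1 \<le> v" "xi o1 = xi o2" "p1 < p2" for o1 o2 p1 p2
    using svm that unfolding simple_value_maximizer_def strictly_def by simp
  have inf: "R A (o2, p2)" if "v < p2" for A o2 p2
    using svm that unfolding simple_value_maximizer_def by (cases A) simp
  have "R (o1, p1) (o2, p2) = ?S (o1, p1) (o2, p2)" for o1 p1 o2 p2
  proof -
    consider "v < p2" | "p2 \<le> v" "v < p1" | "p2 \<le> v" "p1 \<le> v" by linarith
    then show ?thesis
    proof cases
      case 1
      then show ?thesis by (simp add: inf)
    next
      case 2
      have "\<not> R (o2, v + 1) (o2, p2)" using 2 eq[of p2 o2 o2 "v + 1"] by simp
      moreover have "R (o2, v + 1) (o1, p1)" using 2 by (simp add: inf)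
      ultimately show ?thesis using 2 tr by auto
    next
      case 3
      consider "xi o1 < xi o2" | "xi o2 < xi o1" | "xi o1 = xi o2" by linarith
      then show ?thesis
      proof cases
        case k: 3
        have "R (o1, p1) (o2, p1)" using dep[OF k] tot by blast
        then show ?thesis using 3 k eq[of p1 o1 o2 p2] eq[of p2 o2 o1 p1]
          by (cases p1 p2 rule: linorder_cases) auto
      qed (use 3 gt in auto)
    qed
  qed
  then show "R = ?S" by (auto simp: fun_eq_iff)
qed

lemma super_quasilinear_ROI_exists: "\<exists>R. super_quasilinear_ROI \<gamma> v xi R"
proof
  show "super_quasilinear_ROI \<gamma> v xi (\<lambda>(o1, p1) (o2, p2). \<not> satisfies_ROI \<gamma> v p2 \<or>
      satisfies_ROI \<gamma> v p1 \<and> (v - p2) * xi o2 \<le> (v - p1) * xi o1)"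
    unfolding super_quasilinear_ROI_def preference_def transp_def by (auto split: prod.splits)
qed

end

theory Submission
  imports Defs
begin

text \<open>
  Put \<open>w = v / (1 + \<gamma>)\<close>. A pair meets the ROI constraint at value \<open>v\<close> iff it is feasible for a
  simple value maximizer with value \<open>w\<close>, so the claim for \<open>v\<close> follows from truthfulness at \<open>w\<close>.
  If the truthful allocation is strictly larger, then, since the price is at most \<open>w\<close>, the
  quasilinear utility is at least \<open>(v - w) x = v x \<gamma> / (1 + \<gamma>)\<close>; by the gap condition this dominates
  the value, hence (prices being nonnegative) also the utility, of any smaller allocation. In the
  almost-everywhere version, the exceptional \<open>v\<close> form a dilate of a null set.
\<close>

text \<open>Dilation by \<open>c\<close> pushes Lebesgue measure forward to a positive constant
  multiple of itself, so preimages of null sets are null.\<close>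

lemma AE_lborel_mult:
  fixes c :: real
  assumes "c \<noteq> 0" and "AE v in lborel. P v"
  shows "AE v in lborel. P (c * v)"
proof -
  have "AE v in density (distr lborel borel (\<lambda>v. 0 + c * v)) (\<lambda>_. ennreal \<bar>c\<bar>). P v"
    using assms(2) unfolding lborel_real_affine[OF assms(1), of 0, symmetric] .
  then have "AE v in distr lborel borel (\<lambda>v. 0 + c * v). P v"
    using assms(1) by (simp add: AE_density)
  then have "AE v in lborel. P (0 + c * v)"
    by (rule AE_distrD[rotated]) simp
  then show ?thesis
    by simp
qed

lemma simple_value_maximizer_exists:
  assumes "0 < v"
  obtains R where "simple_value_maximizer v xi R"
  using simple_value_maximizer_iff[OF assms] by blast

text \<open>Since \<open>no_gain_SVM\<close> quantifies over preferences, an existing one must be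
  supplied; its explicit form then yields the three ways in which a lie can fail to help.\<close>

lemma no_gain_SVM_cases:
  assumes "no_gain_SVM x M i b w" and "0 < w" and "0 < bi"
  shows "w < snd M i (b(i := bi)) \<or>
    x i (fst M (b(i := bi))) < x i (fst M (b(i := w))) \<or>
    x i (fst M (b(i := w))) = x i (fst M (b(i := bi))) \<and> snd M i (b(i := w)) \<le> snd M i (b(i := bi))"
proof -
  obtain R where R: "simple_value_maximizer w (x i) R"
    using assms(2) by (rule simple_value_maximizer_exists)
  with assms have "R (result M i (b(i := w))) (result M i (b(i := bi)))"
    unfolding no_gain_SVM_def by blast
  with R show ?thesis
    unfolding simple_value_maximizer_iff[OF assms(2)] result_def by auto
qed

lemma ROI_utility_gap:
  fixes v \<gamma> p p' a a' :: real
  assumes "0 \<le> \<gamma>" and "0 < v" and "p \<le> v / (1 + \<gamma>)" and "0 \<le> p'" and "0 \<le> a" and "0 \<le> a'"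
    and "v * a' \<le> v * a * (\<gamma> / (\<gamma> + 1))"
  shows "(v - p') * a' \<le> (v - p) * a"
proof -
  have "(v - p') * a' \<le> v * a'"
    using assms by (intro mult_right_mono) auto
  also have "\<dots> \<le> v * a * (\<gamma> / (\<gamma> + 1))"
    by fact
  \<comment> \<open>The factor in the gap condition is exactly the share of value left after paying
    the maximum acceptable price.\<close>
  also have "\<dots> = (v - v / (1 + \<gamma>)) * a"
    using assms(1) by (simp add: field_simps)
  also have "\<dots> \<le> (v - p) * a"
    using assms by (intro mult_right_mono) auto
  finally show ?thesis .
qed

lemma super_quasilinear_ROI_no_gain:
  assumes "0 \<le> \<gamma>" and "0 < v" and "0 < bi" and b: "bid_profile b"
    and nonneg: "\<And>z. 0 \<le> x i z"
    and ir: "individually_rational_SVM M" and npt: "no_positive_transfers M"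
    and sq: "super_quasilinear_ROI \<gamma> v (x i) R"
    and gap: "\<And>z z'. x i z' < x i z \<Longrightarrow> v * x i z * (\<gamma> / (\<gamma> + 1)) \<ge> v * x i z'"
    and no_gain: "no_gain_SVM x M i b (v / (1 + \<gamma>))"
  shows "R (result M i (b(i := v / (1 + \<gamma>)))) (result M i (b(i := bi)))"
proof -
  define w where "w = v / (1 + \<gamma>)"
  define z p where "z = fst M (b(i := w))" and "p = snd M i (b(i := w))"
  define z' p' where "z' = fst M (b(i := bi))" and "p' = snd M i (b(i := bi))"
  have w: "0 < w"
    using assms(1,2) by (simp add: w_def)
  \<comment> \<open>Individual rationality at the bid \<open>w\<close>, not at \<open>v\<close>, is
    what gives the ROI constraint.\<close>
  have p: "p \<le> v / (1 + \<gamma>)"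
    using ir b w unfolding individually_rational_SVM_def p_def w_def by blast
  have "bid_profile (b(i := bi))"
    using b \<open>0 < bi\<close> by (simp add: bid_profile_def)
  then have p': "0 \<le> p'"
    using npt by (simp add: no_positive_transfers_def p'_def)
  have better: "R (z, p) (z', p')" if "x i z' \<le> x i z" "(v - p') * x i z' \<le> (v - p) * x i z"
    using sq p that \<open>0 < v\<close> by (simp add: super_quasilinear_ROI_def satisfies_ROI_def)
  consider "w < p'" | "x i z' < x i z" | "x i z = x i z'" "p \<le> p'"
    using no_gain_SVM_cases[of x M i b w bi] no_gain w \<open>0 < bi\<close>
    unfolding z_def p_def z'_def p'_def w_def by blast
  then have "R (z, p) (z', p')"
  proof cases
    \<comment> \<open>The lie leads to a price violating the ROI constraint, hence to a pair ranked
      lowest.\<close>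
    case 1
    then show ?thesis
      using sq by (simp add: super_quasilinear_ROI_def satisfies_ROI_def w_def)
  next
    case 2
    have "(v - p') * x i z' \<le> (v - p) * x i z"
      using ROI_utility_gap[OF assms(1,2) p p' nonneg nonneg gap[OF 2]] .
    with 2 show ?thesis
      by (intro better) auto
  next
    case 3
    then show ?thesis
      by (intro better) (auto intro: mult_right_mono nonneg)
  qed
  then show ?thesis
    by (simp add: result_def w_def z_def p_def z'_def p'_def)
qed

theorem theorem2:
  fixes \<gamma> :: real
    and x :: "'n::finite \<Rightarrow> 'o \<Rightarrow> real"
    and M :: "('n, 'o) auction"
    and pref :: "'n \<Rightarrow> real \<Rightarrow> 'o pref"
  assumes "0 \<le> \<gamma>"
    and "\<And>i z. x i z \<in> {0..1}"
    and "individually_rational_SVM M"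
    and "no_positive_transfers M"
    and "\<And>i v. 0 < v \<Longrightarrow> super_quasilinear_ROI \<gamma> v (x i) (pref i v)"
    and "\<And>i v z z'. 0 < v \<Longrightarrow> x i z' < x i z \<Longrightarrow> v * x i z * (\<gamma> / (\<gamma> + 1)) \<ge> v * x i z'"
  shows "(DSIC_SVM x M \<longrightarrow>
      (\<forall>i b. bid_profile b \<longrightarrow>
        (\<forall>v>0. \<forall>bi>0.
          pref i v (result M i (b(i := v / (1 + \<gamma>)))) (result M i (b(i := bi)))))) \<and>
    (DSIC_AE_SVM x M \<longrightarrow>
      (\<forall>i b. bid_profile b \<longrightarrow>
        (AE v in lborel. 0 < v \<longrightarrow> (\<forall>bi>0.
          pref i v (result M i (b(i := v / (1 + \<gamma>)))) (result M i (b(i := bi)))))))"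
proof -
  have pointwise: "pref i v (result M i (b(i := v / (1 + \<gamma>)))) (result M i (b(i := bi)))"
    if "bid_profile b" "0 < v" "0 < bi" "no_gain_SVM x M i b (v / (1 + \<gamma>))" for i b v bi
    using assms(1) that(2,3,1) _ assms(3,4) assms(5)[OF that(2)] assms(6)[OF that(2)] that(4)
    by (rule super_quasilinear_ROI_no_gain) (use assms(2) in auto)
  have pos: "0 < v / (1 + \<gamma>)" if "0 < v" for v
    using assms(1) that by simp
  have dsic: "pref i v (result M i (b(i := v / (1 + \<gamma>)))) (result M i (b(i := bi)))"
    if "DSIC_SVM x M" "bid_profile b" "0 < v" "0 < bi" for i b v bi
    using that pos by (intro pointwise) (auto simp: DSIC_SVM_def)
  have dsic_ae: "AE v in lborel. 0 < v \<longrightarrow> (\<forall>bi>0.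
      pref i v (result M i (b(i := v / (1 + \<gamma>)))) (result M i (b(i := bi))))"
    if "DSIC_AE_SVM x M" "bid_profile b" for i b
  proof -
    have "AE v in lborel. 0 < v \<longrightarrow> no_gain_SVM x M i b v"
      using that by (simp add: DSIC_AE_SVM_def)
    \<comment> \<open>Truthfulness is needed at \<open>v / (1 + \<gamma>)\<close>, hence this
      dilation. As \<open>no_gain_SVM\<close> already covers all deviations, a single null set
      serves every \<open>bi\<close>.\<close>
    then have "AE v in lborel. 0 < 1 / (1 + \<gamma>) * v \<longrightarrow> no_gain_SVM x M i b (1 / (1 + \<gamma>) * v)"
      using assms(1) by (intro AE_lborel_mult) auto
    then show ?thesis
      by eventually_elim (use pointwise pos that(2) in auto)
  qed
  from dsic dsic_ae show ?thesis
    by blast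
qed

end
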